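(* Let $a<b$ be real numbers, let $1<\alpha\le 2$ and $0<\beta\le 1$ satisfy $\alpha-\beta-1\ge 0$, and let $f,g\in C[a,b]$ be real-valued. Suppose that $x\in E_\beta$ is a nontrivial solution of the boundary value problem $$(D_a^\alpha x)(t)+g(t)(D_a^\beta x)(t)+f(t)x(t)=0,\quad t\in(a,b),\qquad x(a)=0=x(b).$$ For $s\in[a,b]$ put $$p(s)=\frac{(s-a)^{\alpha-\beta-1}(b-s)^{\alpha-1}}{(b-a)^{\alpha-1}},\qquad r(s)=(b-s)^{\alpha-\beta-1}-\frac{(b-s)^{\alpha-1}}{(b-a)^\beta},$$ and let $m(s)=\max\{p(s),r(s)\}$ if $\alpha-\beta-1>0$, and $m(s)=r(s)$ if $\alpha-\beta-1=0$. Then $$\Gamma(\alpha-\beta)\le\max\left\{\int_a^b m(s)|g(s)|\,ds,\ \int_a^b p(s)|g(s)|\,ds\right\}+\max\left\{\int_a^b m(s)|f(s)|\frac{(s-a)^\beta}{\Gamma(\beta+1)}\,ds,\ \int_a^b p(s)|f(s)|\frac{(s-a)^\beta}{\Gamma(\beta+1)}\,ds\right\}.$$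
   Context: The Riemann--Liouville fractional integral of order $\alpha\ge 0$ of a real function $f$ on $[a,b]$ is $(I_a^0f)(t)=f(t)$ and, for $\alpha>0$, $(I_a^\alpha f)(t)=\frac{1}{\Gamma(\alpha)}\int_a^t(t-s)^{\alpha-1}f(s)\,ds$, $t\in[a,b]$, provided the integral exists. The Riemann--Liouville fractional derivative of order $n-1<\alpha\le n$, $n\in\mathbb{N}$, is $(D_a^\alpha f)(t)=(D^nI_a^{n-\alpha}f)(t)$ with $D^n=\frac{d^n}{dt^n}$, provided the right-hand side exists. The space $E_\beta$ is $E_\beta=\{f\in C^1(a,b]\cap C[a,b]:\ (D_a^\beta f)\in C[a,b]\}$ (real-valued functions). "Nontrivial" means not identically zero on $[a,b]$. Powers with exponent $0$ are equal to $1$. $\Gamma$ is the Gamma function. *)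

theory Defs
  imports "HOL-Analysis.Analysis"
begin

text \<open>
  In the library, \<open>0 powr 0 = 0\<close>; here powers with exponent \<open>0\<close> are equal to \<open>1\<close>,
  including for base \<open>0\<close>. All bases below are nonnegative on the relevant range.
\<close>

definition rpow :: "real \<Rightarrow> real \<Rightarrow> real" where
  "rpow x y = (if y = 0 then 1 else x powr y)"

definition rl_integral_exists :: "real \<Rightarrow> real \<Rightarrow> (real \<Rightarrow> real) \<Rightarrow> real \<Rightarrow> bool" where
  "rl_integral_exists a \<alpha> f t \<longleftrightarrow>
     \<alpha> = 0 \<or> (\<lambda>s. rpow (t - s) (\<alpha> - 1) * f s) integrable_on {a..t}"

text \<open>
  For \<open>\<alpha> < 1\<close> the kernel is singular at \<open>s = t\<close>, where \<open>powr\<close> assigns it the value \<open>0\<close>;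
  a single point does not affect the integral.
\<close>

definition rl_integral :: "real \<Rightarrow> real \<Rightarrow> (real \<Rightarrow> real) \<Rightarrow> real \<Rightarrow> real" where
  "rl_integral a \<alpha> f t =
     (if \<alpha> = 0 then f t
      else 1 / Gamma \<alpha> * integral {a..t} (\<lambda>s. rpow (t - s) (\<alpha> - 1) * f s))"

text \<open>
  Iterated derivatives on a nondegenerate interval \<open>T\<close>: two-sided at interior points of \<open>T\<close> and
  one-sided at endpoints that belong to \<open>T\<close>. The value is only meaningful together with
  the existence predicate.
\<close>

primrec nth_deriv_on :: "real set \<Rightarrow> nat \<Rightarrow> (real \<Rightarrow> real) \<Rightarrow> real \<Rightarrow> real" where
  "nth_deriv_on T 0 h = h"
| "nth_deriv_on T (Suc n) h = (\<lambda>t. vector_derivative (nth_deriv_on T n h) (at t within T))"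

definition nth_differentiable_on :: "real set \<Rightarrow> nat \<Rightarrow> (real \<Rightarrow> real) \<Rightarrow> bool" where
  "nth_differentiable_on T n h \<longleftrightarrow> (\<forall>k<n. nth_deriv_on T k h differentiable_on T)"

text \<open>
  The order \<open>n\<close> with \<open>n - 1 < \<alpha> \<le> n\<close> is \<open>\<lceil>\<alpha>\<rceil>\<close>.
\<close>

definition rl_deriv_exists_on :: "real set \<Rightarrow> real \<Rightarrow> real \<Rightarrow> (real \<Rightarrow> real) \<Rightarrow> bool" where
  "rl_deriv_exists_on T a \<alpha> f \<longleftrightarrow>
     (\<forall>t\<in>T. rl_integral_exists a (of_int \<lceil>\<alpha>\<rceil> - \<alpha>) f t) \<and>
     nth_differentiable_on T (nat \<lceil>\<alpha>\<rceil>) (rl_integral a (of_int \<lceil>\<alpha>\<rceil> - \<alpha>) f)"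

definition rl_deriv_on :: "real set \<Rightarrow> real \<Rightarrow> real \<Rightarrow> (real \<Rightarrow> real) \<Rightarrow> real \<Rightarrow> real" where
  "rl_deriv_on T a \<alpha> f = nth_deriv_on T (nat \<lceil>\<alpha>\<rceil>) (rl_integral a (of_int \<lceil>\<alpha>\<rceil> - \<alpha>) f)"

text \<open>
  Members of \<open>E_space a b \<beta>\<close> are total functions, of which only the values on \<open>[a,b]\<close> matter.
\<close>

definition E_space :: "real \<Rightarrow> real \<Rightarrow> real \<Rightarrow> (real \<Rightarrow> real) set" where
  "E_space a b \<beta> = {x.
     (\<exists>x'. (\<forall>t\<in>{a<..b}. (x has_real_derivative x' t) (at t within {a<..b})) \<and>
           continuous_on {a<..b} x') \<and>
     continuous_on {a..b} x \<and>
     rl_deriv_exists_on {a..b} a \<beta> x \<and>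
     continuous_on {a..b} (rl_deriv_on {a..b} a \<beta> x)}"

text \<open>
  The derivative of order \<open>\<alpha>\<close> is only required to exist on the open interval, whereas the one of
  order \<open>\<beta>\<close> is the function on \<open>[a,b]\<close> from the definition of \<open>E_space\<close>.
\<close>

definition bvp_solution ::
  "real \<Rightarrow> real \<Rightarrow> real \<Rightarrow> real \<Rightarrow> (real \<Rightarrow> real) \<Rightarrow> (real \<Rightarrow> real) \<Rightarrow> (real \<Rightarrow> real) \<Rightarrow> bool" where
  "bvp_solution a b \<alpha> \<beta> f g x \<longleftrightarrow>
     rl_deriv_exists_on {a<..<b} a \<alpha> x \<and>
     (\<forall>t\<in>{a<..<b}.
        rl_deriv_on {a<..<b} a \<alpha> x t + g t * rl_deriv_on {a..b} a \<beta> x t + f t * x t = 0) \<and>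
     x a = 0 \<and> x b = 0"

definition bound_p :: "real \<Rightarrow> real \<Rightarrow> real \<Rightarrow> real \<Rightarrow> real \<Rightarrow> real" where
  "bound_p a b \<alpha> \<beta> s =
     rpow (s - a) (\<alpha> - \<beta> - 1) * rpow (b - s) (\<alpha> - 1) / rpow (b - a) (\<alpha> - 1)"

definition bound_r :: "real \<Rightarrow> real \<Rightarrow> real \<Rightarrow> real \<Rightarrow> real \<Rightarrow> real" where
  "bound_r a b \<alpha> \<beta> s =
     rpow (b - s) (\<alpha> - \<beta> - 1) - rpow (b - s) (\<alpha> - 1) / rpow (b - a) \<beta>"

definition bound_m :: "real \<Rightarrow> real \<Rightarrow> real \<Rightarrow> real \<Rightarrow> real \<Rightarrow> real" where
  "bound_m a b \<alpha> \<beta> s =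
     (if \<alpha> - \<beta> - 1 > 0 then max (bound_p a b \<alpha> \<beta> s) (bound_r a b \<alpha> \<beta> s)
      else bound_r a b \<alpha> \<beta> s)"

end

theory Submission
  imports Defs
begin

text \<open>
  Let \<open>u\<close> be the fractional derivative of order \<open>\<beta>\<close> of the solution \<open>x\<close> and \<open>h = g u + f x\<close>. The idea
  is to rewrite the boundary value problem as an integral equation for \<open>u\<close> instead of \<open>x\<close>,
  \<open>Gamma (\<alpha> - \<beta>) u t = \<integral> G(t,s) h s ds\<close> with an explicit Green function \<open>G\<close>
  (\<open>bvp_solution_green_representation\<close>). Because \<open>x a = 0\<close>, the function \<open>x\<close> is recovered from \<open>u\<close> by
  fractional integration of order \<open>\<beta>\<close> (\<open>rl_integral_rl_deriv\<close>), so the supremum norm of \<open>u\<close> controls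
  \<open>\<bar>x s\<bar>\<close> by a multiple of \<open>(s - a) powr \<beta>\<close> and hence controls \<open>h\<close>. Evaluating the integral equation
  at a point where \<open>\<bar>u\<bar>\<close> is maximal and cancelling this maximum, which is positive because \<open>x\<close> is
  nontrivial, bounds \<open>Gamma (\<alpha> - \<beta>)\<close> by integrals of \<open>\<bar>G\<bar>\<close> against the coefficients.

  It remains to dominate \<open>\<bar>G(t,s)\<bar>\<close> by a weight independent of \<open>t\<close>. For \<open>\<alpha> - \<beta> > 1\<close> monotonicity
  in \<open>t\<close> gives the weight \<open>m\<close> (\<open>abs_green_le_bound_m\<close>). For \<open>\<alpha> - \<beta> = 1\<close> neither \<open>m = r\<close> nor \<open>p\<close> dominates for every \<open>t\<close>, but for
  each single \<open>t\<close> one of the two does (\<open>abs_green_le_bounds\<close>). This is why maxima over the two weights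
  appear in the result.

  The integral equation rests on three facts about fractional integrals of continuous functions:
  they are continuous (\<open>continuous_on_rl_integral\<close>), their orders add under composition
  (\<open>rl_integral_semigroup\<close>), and they determine the integrand (\<open>rl_integral_inject\<close>). The first two
  hold for powers of \<open>s - a\<close> by Euler's Beta integral and carry over to continuous functions by
  Weierstrass approximation.
\<close>

section \<open>The power kernel\<close>

lemma continuous_on_rpow:
  assumes "continuous_on S f" "\<And>s. s \<in> S \<Longrightarrow> 0 \<le> f s" "0 \<le> q"
  shows "continuous_on S (\<lambda>s. rpow (f s) q)"
  using assms by (cases "q = 0") (auto simp: rpow_def intro!: continuous_on_powr')

lemma rpow_of_nat: "0 \<le> x \<Longrightarrow> rpow x (real n) = x ^ n"
  by (auto simp: rpow_def powr_realpow' )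

lemma rpow_nonneg: "0 \<le> rpow x q"
  by (simp add: rpow_def)

lemma Gamma_real_neq_0: "0 < x \<Longrightarrow> Gamma x \<noteq> (0::real)"
  by (metis Gamma_real_pos less_irrefl)

text \<open>
  The substitution \<open>s = a + (t - a) u\<close> turns this into Euler's Beta integral; the two endpoints,
  where the conventions for \<open>0\<close> to the power \<open>0\<close> differ, form a null set.
\<close>

lemma kernel_power_has_integral:
  fixes a t \<delta> \<mu> :: real
  assumes "0 < \<delta>" "0 \<le> \<mu>" "a \<le> t"
  shows "((\<lambda>s. rpow (t - s) (\<delta> - 1) * rpow (s - a) \<mu>) has_integral
           Gamma \<delta> * Gamma (\<mu> + 1) / Gamma (\<mu> + \<delta> + 1) * rpow (t - a) (\<mu> + \<delta>)) {a..t}"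
proof (cases "a = t")
  case True
  then show ?thesis using assms by (simp add: rpow_def has_integral_refl)
next
  case False
  with assms have at: "a < t" by simp
  define L where "L = t - a"
  have L: "L > 0" using at by (simp add: L_def)
  have beta: "((\<lambda>u. u powr \<mu> * (1 - u) powr (\<delta> - 1)) has_integral Beta (\<mu> + 1) \<delta>) (cbox 0 1)"
    using has_integral_Beta_real[of "\<mu> + 1" \<delta>] assms by simp
  have "((\<lambda>s. ((s - a) / L) powr \<mu> * (1 - (s - a) / L) powr (\<delta> - 1)) has_integral
           L * Beta (\<mu> + 1) \<delta>) {a..t}"
  proof -
    have "(0 - - a / L) /\<^sub>R (1 / L) = a" "(1 - - a / L) /\<^sub>R (1 / L) = t"
      "\<And>s. (1 / L) *\<^sub>R s + - a / L = (s - a) / L"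
      using L by (simp_all add: divide_simps) (simp_all add: L_def)
    moreover have "Beta (\<mu> + 1) \<delta> /\<^sub>R (1 / L) ^ DIM(real) = L * Beta (\<mu> + 1) \<delta>"
      using L by (simp add: field_simps)
    ultimately show ?thesis
      using has_integral_affinity'[OF beta, of "1 / L" "- a / L"] L by (simp only: box_real) simp
  qed
  then have "((\<lambda>s. L powr (\<mu> + \<delta> - 1) * (((s - a) / L) powr \<mu> * (1 - (s - a) / L) powr (\<delta> - 1)))
      has_integral L powr (\<mu> + \<delta> - 1) * (L * Beta (\<mu> + 1) \<delta>)) {a..t}"
    by (rule has_integral_mult_right)
  moreover have "L powr (\<mu> + \<delta> - 1) * (L * Beta (\<mu> + 1) \<delta>)
      = Gamma \<delta> * Gamma (\<mu> + 1) / Gamma (\<mu> + \<delta> + 1) * rpow (t - a) (\<mu> + \<delta>)"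
    using L assms powr_add[of L "\<mu> + \<delta> - 1" 1]
    by (simp add: Beta_def rpow_def L_def[symmetric] add_ac)
  moreover have "rpow (t - s) (\<delta> - 1) * rpow (s - a) \<mu>
      = L powr (\<mu> + \<delta> - 1) * (((s - a) / L) powr \<mu> * (1 - (s - a) / L) powr (\<delta> - 1))"
    if "s \<in> {a..t} - {a, t}" for s
  proof -
    have s: "0 < s - a" "0 < t - s" using that by auto
    have e: "1 - (s - a) / L = (t - s) / L" using L by (simp add: L_def field_simps)
    have "L powr (\<mu> + \<delta> - 1) = L powr \<mu> * L powr (\<delta> - 1)"
      by (simp add: powr_add[symmetric] algebra_simps)
    then show ?thesis unfolding e using s L
      by (simp add: rpow_def powr_divide)
  qed
  ultimately show ?thesis
    using has_integral_spike_finite[of "{a, t}" "{a..t}"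
      "\<lambda>s. rpow (t - s) (\<delta> - 1) * rpow (s - a) \<mu>"] by auto
qed

lemma rl_integral_power:
  assumes "0 < \<delta>" "0 \<le> \<mu>" "a \<le> t"
  shows "rl_integral a \<delta> (\<lambda>s. rpow (s - a) \<mu>) t =
           Gamma (\<mu> + 1) / Gamma (\<mu> + \<delta> + 1) * rpow (t - a) (\<mu> + \<delta>)"
  using kernel_power_has_integral[OF assms] assms Gamma_real_neq_0[OF assms(1)]
  by (simp add: rl_integral_def integral_unique)

text \<open>
  For \<open>\<delta> < 1\<close> the kernel is unbounded, but it is nonnegative with finite integral, hence
  absolutely integrable, and multiplication by a bounded measurable factor preserves this.
\<close>

lemma kernel_integrable:
  fixes f :: "real \<Rightarrow> real"
  assumes "0 < \<delta>" "continuous_on {a..t} f"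
  shows "(\<lambda>s. rpow (t - s) (\<delta> - 1) * f s) integrable_on {a..t}"
proof (cases "a \<le> t")
  case True
  have "(\<lambda>s. rpow (t - s) (\<delta> - 1)) integrable_on {a..t}"
    using kernel_power_has_integral[OF assms(1) _ True, of 0]
    by (auto simp: rpow_def[of _ 0] integrable_on_def)
  then have "(\<lambda>s. rpow (t - s) (\<delta> - 1)) absolutely_integrable_on {a..t}"
    by (rule nonnegative_absolutely_integrable_1) (simp add: rpow_nonneg)
  then have "(\<lambda>s. f s * rpow (t - s) (\<delta> - 1)) absolutely_integrable_on {a..t}"
    by (intro absolutely_integrable_bounded_measurable_product_real
        continuous_imp_measurable_on_sets_lebesgue assms compact_imp_bounded
        compact_continuous_image) auto
  then show ?thesis
    by (simp add: absolutely_integrable_on_def mult.commute)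
qed auto

section \<open>Fractional integrals of continuous functions\<close>

lemma rl_integral_cong:
  assumes "\<And>s. s \<in> {a..t} \<Longrightarrow> f s = g s" "a \<le> t"
  shows "rl_integral a \<delta> f t = rl_integral a \<delta> g t"
proof -
  have "integral {a..t} (\<lambda>s. rpow (t - s) (\<delta> - 1) * f s)
      = integral {a..t} (\<lambda>s. rpow (t - s) (\<delta> - 1) * g s)"
    using assms by (intro integral_cong) auto
  then show ?thesis using assms by (simp add: rl_integral_def)
qed

lemma rl_integral_at_start: "\<delta> \<noteq> 0 \<Longrightarrow> rl_integral a \<delta> f a = 0"
  by (simp add: rl_integral_def)

lemma rl_integral_cmult: "rl_integral a \<delta> (\<lambda>s. c * f s) t = c * rl_integral a \<delta> f t"
proof -
  have "(\<lambda>s. rpow (t - s) (\<delta> - 1) * (c * f s)) = (\<lambda>s. c * (rpow (t - s) (\<delta> - 1) * f s))"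
    by (simp add: mult_ac)
  then show ?thesis by (simp add: rl_integral_def)
qed

lemma rl_integral_add:
  assumes "0 < \<delta>" "continuous_on {a..t} f" "continuous_on {a..t} g"
  shows "rl_integral a \<delta> (\<lambda>s. f s + g s) t = rl_integral a \<delta> f t + rl_integral a \<delta> g t"
  using assms kernel_integrable[of \<delta> a t f] kernel_integrable[of \<delta> a t g]
  by (simp add: rl_integral_def distrib_left integral_add)

lemma rl_integral_diff:
  assumes "0 < \<delta>" "continuous_on {a..t} f" "continuous_on {a..t} g"
  shows "rl_integral a \<delta> (\<lambda>s. f s - g s) t = rl_integral a \<delta> f t - rl_integral a \<delta> g t"
  using assms kernel_integrable[of \<delta> a t f] kernel_integrable[of \<delta> a t g]
  by (simp add: rl_integral_def right_diff_distrib integral_diff)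

lemma rl_integral_sum:
  assumes "0 < \<delta>" "finite I" "\<And>i. i \<in> I \<Longrightarrow> continuous_on {a..t} (f i)"
  shows "rl_integral a \<delta> (\<lambda>s. \<Sum>i\<in>I. f i s) t = (\<Sum>i\<in>I. rl_integral a \<delta> (f i) t)"
  using assms(2,3)
proof (induction I rule: finite_induct)
  case empty
  then show ?case by (simp add: rl_integral_def)
next
  case (insert i I)
  then show ?case
    by (simp add: rl_integral_add[OF assms(1)] continuous_on_sum)
qed

text \<open>
  Comparison with the fractional integral of the constant \<open>M\<close>.
\<close>

lemma rl_integral_bound:
  assumes "0 < \<delta>" "a \<le> t" "continuous_on {a..t} f" "\<And>s. s \<in> {a..t} \<Longrightarrow> \<bar>f s\<bar> \<le> M"
  shows "\<bar>rl_integral a \<delta> f t\<bar> \<le> M * (rpow (t - a) \<delta> / Gamma (\<delta> + 1))"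
proof -
  have "\<bar>integral {a..t} (\<lambda>s. rpow (t - s) (\<delta> - 1) * f s)\<bar>
      \<le> integral {a..t} (\<lambda>s. rpow (t - s) (\<delta> - 1) * M)"
    unfolding real_norm_def[symmetric]
    using kernel_integrable[OF assms(1,3)] kernel_integrable[of \<delta> a t "\<lambda>_. M"] assms
    by (intro integral_norm_bound_integral) (auto simp: abs_mult rpow_nonneg intro!: mult_left_mono)
  then have "\<bar>rl_integral a \<delta> f t\<bar> \<le> rl_integral a \<delta> (\<lambda>s. M * rpow (s - a) 0) t"
    using assms Gamma_real_pos[of \<delta>]
    by (auto simp: rl_integral_def rpow_def[of _ 0] abs_mult divide_right_mono)
  also have "\<dots> = M * (rpow (t - a) \<delta> / Gamma (\<delta> + 1))"
    unfolding rl_integral_cmult using rl_integral_power[OF assms(1) order_refl assms(2)] by simp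
  finally show ?thesis .
qed

text \<open>
  Weierstrass approximation, with the polynomial expanded around the left endpoint so that
  fractional integration acts on every term by the power rule.
\<close>

lemma approx_by_powers:
  fixes f :: "real \<Rightarrow> real"
  assumes "continuous_on {a..b} f" "0 < e"
  obtains c n where "\<And>s. s \<in> {a..b} \<Longrightarrow> \<bar>f s - (\<Sum>i\<le>n. c i * rpow (s - a) (real i))\<bar> \<le> e"
proof -
  have "continuous_on {0..b - a} (\<lambda>u. f (u + a))"
    by (intro continuous_on_compose2[OF assms(1)] continuous_intros) auto
  then obtain q where q: "real_polynomial_function q"
      "\<And>u. u \<in> {0..b - a} \<Longrightarrow> \<bar>f (u + a) - q u\<bar> < e"
    using Stone_Weierstrass_real_polynomial_function[of "{0..b - a}"] assms(2) by (metis compact_Icc)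
  then obtain c n where c: "q = (\<lambda>u. \<Sum>i\<le>n. c i * u ^ i)"
    using real_polynomial_function_iff_sum by metis
  show ?thesis
  proof
    show "\<bar>f s - (\<Sum>i\<le>n. c i * rpow (s - a) (real i))\<bar> \<le> e" if "s \<in> {a..b}" for s
      using q(2)[of "s - a"] that by (simp add: c rpow_of_nat)
  qed
qed

lemma rl_integral_power_sum:
  assumes "0 < \<delta>" "a \<le> t" "0 \<le> \<nu>"
  shows "rl_integral a \<delta> (\<lambda>s. \<Sum>i\<le>n. c i * rpow (s - a) (real i + \<nu>)) t =
           (\<Sum>i\<le>n. c i * Gamma (real i + \<nu> + 1) / Gamma (real i + \<nu> + \<delta> + 1)
              * rpow (t - a) (real i + \<nu> + \<delta>))"
proof -
  have "rl_integral a \<delta> (\<lambda>s. \<Sum>i\<le>n. c i * rpow (s - a) (real i + \<nu>)) t =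
      (\<Sum>i\<le>n. rl_integral a \<delta> (\<lambda>s. c i * rpow (s - a) (real i + \<nu>)) t)"
    using assms by (intro rl_integral_sum continuous_intros continuous_on_rpow) auto
  then show ?thesis
    using assms by (simp add: rl_integral_cmult rl_integral_power mult.assoc)
qed

lemma rl_integral_bound_uniform:
  assumes "0 < \<delta>" "t \<in> {a..b}" "continuous_on {a..b} f" "\<And>s. s \<in> {a..b} \<Longrightarrow> \<bar>f s\<bar> \<le> M"
  shows "\<bar>rl_integral a \<delta> f t\<bar> \<le> M * ((b - a) powr \<delta> / Gamma (\<delta> + 1))"
proof -
  have M: "0 \<le> M" using assms(4)[OF assms(2)] by linarith
  have "\<bar>rl_integral a \<delta> f t\<bar> \<le> M * (rpow (t - a) \<delta> / Gamma (\<delta> + 1))"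
    using assms by (intro rl_integral_bound) (auto intro: continuous_on_subset)
  also have "\<dots> \<le> M * ((b - a) powr \<delta> / Gamma (\<delta> + 1))"
    using M assms Gamma_real_pos[of "\<delta> + 1"]
    by (intro mult_left_mono divide_right_mono) (auto simp: rpow_def intro: powr_mono2)
  finally show ?thesis .
qed

text \<open>
  By the uniform bound, fractional integration maps uniformly convergent sequences to uniformly
  convergent ones. The image of a polynomial is a combination of powers of \<open>s - a\<close> with positive
  exponents, so the image of a continuous function is a uniform limit of continuous functions.
\<close>

lemma continuous_on_rl_integral:
  assumes "0 < \<delta>" "continuous_on {a..b} f"
  shows "continuous_on {a..b} (rl_integral a \<delta> f)"
proof -
  define K where "K = (b - a) powr \<delta> / Gamma (\<delta> + 1)"
  have K: "0 \<le> K" unfolding K_def using assms Gamma_real_pos[of "\<delta> + 1"] by auto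
  have "\<exists>P. continuous_on {a..b} P \<and> (\<forall>t\<in>{a..b}. \<bar>rl_integral a \<delta> f t - P t\<bar> < e)" if e: "0 < e" for e
  proof -
    have e': "0 < e / (K + 1)" using K e by simp
    obtain c n where c: "\<And>s. s \<in> {a..b} \<Longrightarrow> \<bar>f s - (\<Sum>i\<le>n. c i * rpow (s - a) (real i))\<bar> \<le> e / (K + 1)"
      using approx_by_powers[OF assms(2) e'] by blast
    define P where "P = (\<lambda>s. \<Sum>i\<le>n. c i * rpow (s - a) (real i + 0))"
    have cP: "continuous_on {a..b} P"
      unfolding P_def by (intro continuous_intros continuous_on_rpow) auto
    have "continuous_on {a..b} (rl_integral a \<delta> P)"
      unfolding P_def using assms
      by (subst continuous_on_cong[OF refl rl_integral_power_sum])
         (auto intro!: continuous_intros continuous_on_rpow Gamma_real_neq_0)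
    moreover have "\<bar>rl_integral a \<delta> f t - rl_integral a \<delta> P t\<bar> < e" if t: "t \<in> {a..b}" for t
    proof -
      have "rl_integral a \<delta> f t - rl_integral a \<delta> P t = rl_integral a \<delta> (\<lambda>s. f s - P s) t"
        using t assms cP by (intro rl_integral_diff[symmetric]) (auto intro: continuous_on_subset)
      moreover have "\<bar>rl_integral a \<delta> (\<lambda>s. f s - P s) t\<bar> \<le> e / (K + 1) * K"
        unfolding K_def using c t assms cP
        by (intro rl_integral_bound_uniform) (auto simp: P_def K_def[symmetric] intro!: continuous_intros)
      moreover have "e / (K + 1) * K < e" using e K by (simp add: field_simps)
      ultimately show ?thesis by simp
    qed
    ultimately show ?thesis by blast
  qed
  then have "\<forall>n. \<exists>P. continuous_on {a..b} P \<and>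
      (\<forall>t\<in>{a..b}. \<bar>rl_integral a \<delta> f t - P t\<bar> < 1 / real (Suc n))"
    by simp
  then obtain P where P: "\<And>n::nat. continuous_on {a..b} (P n)"
      "\<And>n t. t \<in> {a..b} \<Longrightarrow> \<bar>rl_integral a \<delta> f t - P n t\<bar> < 1 / real (Suc n)"
    by metis
  have "uniform_limit {a..b} P (rl_integral a \<delta> f) sequentially"
  proof (rule uniform_limitI)
    fix e :: real assume "0 < e"
    then obtain N where N: "1 / real (Suc N) < e" using nat_approx_posE by blast
    show "\<forall>\<^sub>F n in sequentially. \<forall>t\<in>{a..b}. dist (P n t) (rl_integral a \<delta> f t) < e"
      unfolding eventually_sequentially
    proof (intro exI[of _ N] allI impI ballI)
      fix n t assume n: "N \<le> n" "t \<in> {a..b}"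
      have "1 / real (Suc n) \<le> 1 / real (Suc N)" using n by (simp add: frac_le)
      then show "dist (P n t) (rl_integral a \<delta> f t) < e"
        using P(2)[OF n(2), of n] N by (simp add: dist_real_def abs_minus_commute)
    qed
  qed
  then show ?thesis
    by (rule uniform_limit_theorem[rotated]) (use P in auto)
qed

text \<open>
  Both sides are linear in \<open>f\<close> and bounded in the supremum norm, and for powers of \<open>s - a\<close> the
  identity is the cancellation of Gamma factors in the power rule. Density of polynomials extends
  it to continuous \<open>f\<close>, which avoids exchanging the order of integration in a singular double
  integral.
\<close>

lemma rl_integral_semigroup:
  assumes "0 < \<delta>" "0 < \<epsilon>" "continuous_on {a..b} f" "t \<in> {a..b}"
  shows "rl_integral a \<delta> (rl_integral a \<epsilon> f) t = rl_integral a (\<delta> + \<epsilon>) f t"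
proof -
  define K where "K \<nu> = (b - a) powr \<nu> / Gamma (\<nu> + 1)" for \<nu>
  have K: "0 \<le> K \<nu>" if "0 < \<nu>" for \<nu>
    unfolding K_def using that Gamma_real_pos[of "\<nu> + 1"] by auto
  define C where "C = K \<epsilon> * K \<delta> + K (\<delta> + \<epsilon>)"
  have C: "0 \<le> C" unfolding C_def using K assms by (auto intro!: add_nonneg_nonneg mult_nonneg_nonneg)
  define D where "D = \<bar>rl_integral a \<delta> (rl_integral a \<epsilon> f) t - rl_integral a (\<delta> + \<epsilon>) f t\<bar>"
  have "D \<le> e" if e: "0 < e" for e
  proof -
    define d where "d = e / (C + 1)"
    have d: "0 < d" "d * C \<le> e" using C e by (auto simp: d_def field_simps)
    obtain c n where c: "\<And>s. s \<in> {a..b} \<Longrightarrow> \<bar>f s - (\<Sum>i\<le>n. c i * rpow (s - a) (real i))\<bar> \<le> d"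
      using approx_by_powers[OF assms(3) d(1)] by blast
    define P where "P = (\<lambda>s. \<Sum>i\<le>n. c i * rpow (s - a) (real i + 0))"
    have cP: "continuous_on {a..b} P"
      unfolding P_def by (intro continuous_intros continuous_on_rpow) auto
    have at: "a \<le> t" using assms by simp
    have diff: "rl_integral a \<nu> f s - rl_integral a \<nu> P s = rl_integral a \<nu> (\<lambda>s. f s - P s) s"
      if "s \<in> {a..b}" "0 < \<nu>" for s \<nu>
      using that assms cP by (intro rl_integral_diff[symmetric]) (auto intro: continuous_on_subset)
    have bd: "\<bar>rl_integral a \<nu> f s - rl_integral a \<nu> P s\<bar> \<le> d * K \<nu>"
      if s: "s \<in> {a..b}" and nu: "0 < \<nu>" for s \<nu>
      unfolding diff[OF s nu] K_def using that assms cP c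
      by (intro rl_integral_bound_uniform) (auto simp: P_def intro!: continuous_intros)
    have "rl_integral a \<delta> (rl_integral a \<epsilon> P) t =
        rl_integral a \<delta> (\<lambda>s. \<Sum>i\<le>n. c i * Gamma (real i + 1) / Gamma (real i + \<epsilon> + 1)
              * rpow (s - a) (real i + \<epsilon>)) t"
      using rl_integral_power_sum[OF assms(2), of a _ 0 c n] at
      by (intro rl_integral_cong) (auto simp: P_def)
    also have "\<dots> = rl_integral a (\<delta> + \<epsilon>) P t"
    proof -
      have "Gamma (real i + \<epsilon> + 1) \<noteq> 0" for i
        using assms by (intro Gamma_real_neq_0) auto
      then have "(\<Sum>i\<le>n. c i * Gamma (real i + 1) / Gamma (real i + \<epsilon> + 1) * Gamma (real i + \<epsilon> + 1)
            / Gamma (real i + \<epsilon> + \<delta> + 1) * rpow (t - a) (real i + \<epsilon> + \<delta>)) =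
          (\<Sum>i\<le>n. c i * Gamma (real i + 0 + 1) / Gamma (real i + 0 + (\<delta> + \<epsilon>) + 1)
            * rpow (t - a) (real i + 0 + (\<delta> + \<epsilon>)))"
        by (intro sum.cong) (simp_all add: add_ac)
      then show ?thesis
        unfolding P_def using assms at
        by (subst (1 2) rl_integral_power_sum) auto
    qed
    finally have eqP: "rl_integral a \<delta> (rl_integral a \<epsilon> P) t = rl_integral a (\<delta> + \<epsilon>) P t" .
    have cs: "continuous_on {a..b} (rl_integral a \<epsilon> f)" "continuous_on {a..b} (rl_integral a \<epsilon> P)"
      using continuous_on_rl_integral assms cP by auto
    have "\<bar>rl_integral a \<delta> (\<lambda>s. rl_integral a \<epsilon> f s - rl_integral a \<epsilon> P s) t\<bar> \<le> d * K \<epsilon> * K \<delta>"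
      unfolding K_def[of \<delta>] using cs assms bd
      by (intro rl_integral_bound_uniform continuous_intros) auto
    moreover have "rl_integral a \<delta> (\<lambda>s. rl_integral a \<epsilon> f s - rl_integral a \<epsilon> P s) t
       = rl_integral a \<delta> (rl_integral a \<epsilon> f) t - rl_integral a \<delta> (rl_integral a \<epsilon> P) t"
      using cs assms by (intro rl_integral_diff) (auto intro: continuous_on_subset)
    moreover have "\<bar>rl_integral a (\<delta> + \<epsilon>) f t - rl_integral a (\<delta> + \<epsilon>) P t\<bar> \<le> d * K (\<delta> + \<epsilon>)"
      using bd assms by auto
    ultimately have "D \<le> d * K \<epsilon> * K \<delta> + d * K (\<delta> + \<epsilon>)"
      unfolding D_def using eqP by linarith
    also have "\<dots> = d * C" by (simp add: C_def algebra_simps)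
    finally show ?thesis using d by simp
  qed
  then have "D \<le> 0" by (meson dense_ge)
  then show ?thesis by (simp add: D_def)
qed

lemma rl_integral_1: "rl_integral a 1 f t = integral {a..t} f"
  by (simp add: rl_integral_def rpow_def)

lemma rl_integral_1_has_derivative:
  assumes "continuous_on {a..b} f" "t \<in> {a..b}"
  shows "(rl_integral a 1 f has_real_derivative f t) (at t within {a..b})"
  using integral_has_real_derivative[OF assms] by (simp add: rl_integral_1[abs_def])

text \<open>
  Applying the integral of order \<open>1 - \<delta>\<close> reduces this to order \<open>1\<close>, where differentiation
  recovers the function.
\<close>

lemma rl_integral_inject:
  assumes "0 < \<delta>" "\<delta> \<le> 1" "a < b" "continuous_on {a..b} f" "continuous_on {a..b} g"
    and eq: "\<And>t. t \<in> {a..b} \<Longrightarrow> rl_integral a \<delta> f t = rl_integral a \<delta> g t"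
    and t: "t \<in> {a..b}"
  shows "f t = g t"
proof -
  have eq1: "rl_integral a 1 f s = rl_integral a 1 g s" if s: "s \<in> {a..b}" for s
  proof (cases "\<delta> = 1")
    case False
    then have d: "0 < 1 - \<delta>" using assms by simp
    have "rl_integral a (1 - \<delta>) (rl_integral a \<delta> f) s = rl_integral a (1 - \<delta>) (rl_integral a \<delta> g) s"
      by (rule rl_integral_cong) (use s eq in auto)
    then show ?thesis
      using rl_integral_semigroup[OF d assms(1) assms(4) s]
        rl_integral_semigroup[OF d assms(1) assms(5) s] by simp
  qed (use eq s in auto)
  have "(rl_integral a 1 f has_real_derivative g t) (at t within {a..b})"
    using rl_integral_1_has_derivative[OF assms(5) t] eq1
    unfolding has_real_derivative_iff_has_vector_derivative
    by (rule has_vector_derivative_transform[OF t, rotated])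
  then show ?thesis
    using rl_integral_1_has_derivative[OF assms(4) t] t assms(3)
    unfolding has_real_derivative_iff_has_vector_derivative
    by (metis vector_derivative_unique_within_closed_interval atLeastAtMost_iff cbox_interval)
qed

section \<open>From fractional derivatives to fractional integrals\<close>

text \<open>
  In general \<open>x\<close> and the fractional integral of its fractional derivative differ by a multiple of
  \<open>(t - a) powr (\<beta> - 1)\<close>. The coefficient is proportional to the initial value of the
  integral of order \<open>1 - \<beta>\<close> of \<open>x\<close>, which vanishes because \<open>x\<close> is continuous with \<open>x a = 0\<close>. Hence that integral equals the
  ordinary primitive of the derivative \<open>u\<close>, which is the integral of order \<open>1 - \<beta>\<close> of the integral
  of order \<open>\<beta>\<close> of \<open>u\<close>, and injectivity removes the outer integral.
\<close>

lemma rl_integral_rl_deriv: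
  assumes "a < b" "0 < \<beta>" "\<beta> \<le> 1" "continuous_on {a..b} x" "x a = 0"
    and ex: "rl_deriv_exists_on {a..b} a \<beta> x"
    and cont: "continuous_on {a..b} (rl_deriv_on {a..b} a \<beta> x)"
    and t: "t \<in> {a..b}"
  shows "x t = rl_integral a \<beta> (rl_deriv_on {a..b} a \<beta> x) t"
proof -
  have ceil: "\<lceil>\<beta>\<rceil> = 1" using assms by (simp add: ceiling_eq_iff)
  define u where "u = rl_deriv_on {a..b} a \<beta> x"
  define v where "v = rl_integral a (1 - \<beta>) x"
  have "v differentiable_on {a..b}"
    using ex by (simp add: rl_deriv_exists_on_def nth_differentiable_on_def ceil v_def)
  moreover have "u = (\<lambda>s. vector_derivative v (at s within {a..b}))"
    by (simp add: u_def rl_deriv_on_def ceil v_def)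
  ultimately have dv: "(v has_vector_derivative u s) (at s within {a..b})" if "s \<in> {a..b}" for s
    using that by (simp add: differentiable_on_def vector_derivative_works)
  have va: "v a = 0"
    using assms by (cases "\<beta> = 1") (auto simp: v_def rl_integral_at_start rl_integral_def[of a 0])
  have v_int: "v s = rl_integral a 1 u s" if s: "s \<in> {a..b}" for s
  proof -
    have "(u has_integral (v s - v a)) {a..s}"
      using s by (intro fundamental_theorem_of_calculus)
        (auto intro: has_vector_derivative_within_subset[OF dv])
    then show ?thesis by (simp add: va rl_integral_1 integral_unique)
  qed
  have "x t = rl_integral a \<beta> u t"
  proof (cases "\<beta> = 1")
    case True
    then show ?thesis using v_int[OF t] by (simp add: v_def rl_integral_def[of a 0])
  next
    case False
    then have b: "0 < 1 - \<beta>" using assms by simp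
    have cu: "continuous_on {a..b} u" using cont by (simp add: u_def)
    show ?thesis
    proof (rule rl_integral_inject[OF b _ \<open>a < b\<close> assms(4) _ _ t])
      show "continuous_on {a..b} (rl_integral a \<beta> u)"
        using continuous_on_rl_integral[OF assms(2) cu] .
      show "rl_integral a (1 - \<beta>) x s = rl_integral a (1 - \<beta>) (rl_integral a \<beta> u) s"
        if "s \<in> {a..b}" for s
        using v_int[OF that] rl_integral_semigroup[OF b assms(2) cu that] by (simp add: v_def)
    qed (use assms in auto)
  qed
  then show ?thesis by (simp add: u_def)
qed

text \<open>
  The derivative of order \<open>\<alpha>\<close> is the ordinary second derivative of the integral of order \<open>2 - \<alpha>\<close>.
  Subtracting a twofold primitive of \<open>k\<close> leaves a function with vanishing second derivative on the
  open interval. It is continuous up to \<open>a\<close> and zero there, hence a multiple of \<open>t - a\<close>.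
\<close>

lemma rl_integral_of_continuous_rl_deriv:
  assumes "a < b" "1 < \<alpha>" "\<alpha> \<le> 2" "continuous_on {a..b} x" "x a = 0"
    and ex: "rl_deriv_exists_on {a<..<b} a \<alpha> x"
    and k: "continuous_on {a..b} k" "\<And>t. t \<in> {a<..<b} \<Longrightarrow> rl_deriv_on {a<..<b} a \<alpha> x t = k t"
  obtains c where "\<And>t. t \<in> {a..b} \<Longrightarrow> rl_integral a (2 - \<alpha>) x t = c * (t - a) + rl_integral a 2 k t"
proof -
  have ceil: "\<lceil>\<alpha>\<rceil> = 2" using assms by (simp add: ceiling_eq_iff)
  define y where "y = rl_integral a (2 - \<alpha>) x"
  define y' where "y' = (\<lambda>t. vector_derivative y (at t within {a<..<b}))"
  have two: "{..<2::nat} = {0, 1}" by auto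
  have dd: "y differentiable_on {a<..<b}" "y' differentiable_on {a<..<b}"
    using ex unfolding rl_deriv_exists_on_def nth_differentiable_on_def ceil y_def y'_def
    by (auto dest: spec[of _ 0] spec[of _ 1])
  have kd: "k t = vector_derivative y' (at t within {a<..<b})" if "t \<in> {a<..<b}" for t
    using k(2)[OF that] by (simp add: rl_deriv_on_def ceil y_def y'_def numeral_2_eq_2)
  have dy: "(y has_real_derivative y' t) (at t)" if "t \<in> {a<..<b}" for t
  proof -
    have "(y has_vector_derivative y' t) (at t within {a<..<b})"
      using dd(1) that by (simp add: y'_def differentiable_on_def vector_derivative_works)
    then show ?thesis
      using that by (simp add: has_real_derivative_iff_has_vector_derivative at_within_open[of t "{a<..<b}"])
  qed
  have dy': "(y' has_real_derivative k t) (at t)" if "t \<in> {a<..<b}" for t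
  proof -
    have "(y' has_vector_derivative k t) (at t within {a<..<b})"
      using dd(2) that by (simp add: kd differentiable_on_def vector_derivative_works)
    then show ?thesis
      using that by (simp add: has_real_derivative_iff_has_vector_derivative at_within_open[of t "{a<..<b}"])
  qed
  define k1 where "k1 = rl_integral a 1 k"
  define k2 where "k2 = rl_integral a 1 k1"
  have c1: "continuous_on {a..b} k1" unfolding k1_def by (intro continuous_on_rl_integral k) simp
  have c2: "continuous_on {a..b} k2" unfolding k2_def by (intro continuous_on_rl_integral c1) simp
  have at_eq: "at t within {a..b} = at t" if "t \<in> {a<..<b}" for t
    using that by (intro at_within_interior) auto
  have dk1: "(k1 has_real_derivative k t) (at t)" if "t \<in> {a<..<b}" for t
    using rl_integral_1_has_derivative[OF k(1), of t] at_eq[OF that] that by (simp add: k1_def)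
  have dk2: "(k2 has_real_derivative k1 t) (at t)" if "t \<in> {a<..<b}" for t
    using rl_integral_1_has_derivative[OF c1, of t] at_eq[OF that] that by (simp add: k2_def)
  have "\<exists>c. \<forall>t\<in>{a<..<b}. y' t - k1 t = c"
  proof (rule has_field_derivative_zero_constant)
    show "((\<lambda>t. y' t - k1 t) has_real_derivative 0) (at t within {a<..<b})"
      if "t \<in> {a<..<b}" for t
      using DERIV_diff[OF dy'[OF that] dk1[OF that]] by (auto intro: has_field_derivative_at_within)
  qed simp
  then obtain c where c: "\<And>t. t \<in> {a<..<b} \<Longrightarrow> y' t = c + k1 t"
    by (auto simp: algebra_simps)
  define w where "w t = y t - k2 t - c * (t - a)" for t
  have cy: "continuous_on {a..b} y"
    unfolding y_def using assms continuous_on_rl_integral[of "2 - \<alpha>" a b x]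
    by (cases "\<alpha> = 2") (auto simp: rl_integral_def[of a 0, abs_def])
  have ya: "y a = 0"
    using assms by (cases "\<alpha> = 2") (auto simp: y_def rl_integral_at_start rl_integral_def[of a 0])
  have cw: "continuous_on {a..b} w"
    unfolding w_def by (intro continuous_intros cy c2)
  have dw: "(w has_real_derivative 0) (at t)" if "a < t" "t < b" for t
    unfolding w_def using that dy[of t] dk2[of t] c[of t]
    by (auto intro!: derivative_eq_intros)
  have "w t = w a" if "t \<in> {a..b}" for t
    using DERIV_isconst2[OF \<open>a < b\<close> cw dw, of t] that by auto
  moreover have "w a = 0" by (simp add: w_def ya k2_def rl_integral_at_start)
  moreover have "k2 t = rl_integral a 2 k t" if "t \<in> {a..b}" for t
    using rl_integral_semigroup[of 1 1 a b k t] that k by (simp add: k2_def k1_def)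
  ultimately have "y t = c * (t - a) + rl_integral a 2 k t" if "t \<in> {a..b}" for t
    using that by (force simp: w_def)
  then show ?thesis using that[of c] by (simp add: y_def)
qed

section \<open>The Green representation\<close>

text \<open>
  Write \<open>\<gamma> = \<alpha> - \<beta>\<close>. The equation, integrated twice, says that the integral of order \<open>2 - \<gamma>\<close> of
  \<open>u\<close> is \<open>c (t - a)\<close> minus the integral of order \<open>2\<close> of \<open>h\<close>. Both terms are themselves integrals of
  order \<open>2 - \<gamma>\<close>, namely of a multiple of \<open>(t - a) powr (\<gamma> - 1)\<close> and of the integral of order \<open>\<gamma>\<close> of
  \<open>h\<close>, so injectivity determines \<open>u\<close> up to \<open>c\<close>. Integrating once more with order \<open>\<beta>\<close> gives \<open>x\<close>, and
  \<open>x b = 0\<close> fixes \<open>c\<close>.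
\<close>

lemma bvp_solution_green_representation:
  fixes a b \<alpha> \<beta> :: real and f g x :: "real \<Rightarrow> real"
  defines "u \<equiv> rl_deriv_on {a..b} a \<beta> x"
  defines "h \<equiv> \<lambda>s. g s * u s + f s * x s"
  assumes "a < b" "1 < \<alpha>" "\<alpha> \<le> 2" "0 < \<beta>" "\<beta> \<le> 1" "\<alpha> - \<beta> - 1 \<ge> 0"
    and fg: "continuous_on {a..b} f" "continuous_on {a..b} g"
    and E: "x \<in> E_space a b \<beta>"
    and bvp: "bvp_solution a b \<alpha> \<beta> f g x"
    and t: "t \<in> {a..b}"
  shows "Gamma (\<alpha> - \<beta>) * u t =
      rpow (t - a) (\<alpha> - \<beta> - 1) * integral {a..b} (\<lambda>s. rpow (b - s) (\<alpha> - 1) * h s)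
        / rpow (b - a) (\<alpha> - 1)
      - integral {a..t} (\<lambda>s. rpow (t - s) (\<alpha> - \<beta> - 1) * h s)"
proof -
  define \<gamma> where "\<gamma> = \<alpha> - \<beta>"
  have \<gamma>: "1 \<le> \<gamma>" "\<gamma> < 2" "\<beta> + \<gamma> = \<alpha>" using assms by (auto simp: \<gamma>_def)
  have cx: "continuous_on {a..b} x" and cu: "continuous_on {a..b} u"
    and exb: "rl_deriv_exists_on {a..b} a \<beta> x"
    using E by (auto simp: E_space_def u_def)
  have xab: "x a = 0" "x b = 0" and exa: "rl_deriv_exists_on {a<..<b} a \<alpha> x"
    using bvp by (auto simp: bvp_solution_def)
  have ch: "continuous_on {a..b} h" unfolding h_def by (intro continuous_intros fg cu cx)
  have xu: "x s = rl_integral a \<beta> u s" if "s \<in> {a..b}" for s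
    unfolding u_def using assms cx xab exb cu that by (intro rl_integral_rl_deriv) auto
  obtain c where c: "\<And>s. s \<in> {a..b} \<Longrightarrow>
      rl_integral a (2 - \<alpha>) x s = c * (s - a) + rl_integral a 2 (\<lambda>s. - h s) s"
  proof (rule rl_integral_of_continuous_rl_deriv[OF _ _ _ cx xab(1) exa])
    show "rl_deriv_on {a<..<b} a \<alpha> x s = - h s" if "s \<in> {a<..<b}" for s
      using bvp that by (force simp: bvp_solution_def h_def u_def)
  qed (use assms(3-8) continuous_on_minus[OF ch] in auto)
  have neg: "rl_integral a \<nu> (\<lambda>s. - h s) s = - rl_integral a \<nu> h s" for \<nu> s
    using rl_integral_cmult[of a \<nu> "-1" h s] by simp
  \<comment> \<open>The candidate for \<open>u\<close> obtained by formally cancelling the integral of order \<open>2 - \<gamma>\<close>.\<close>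
  define U where "U s = c / Gamma \<gamma> * rpow (s - a) (\<gamma> - 1) - rl_integral a \<gamma> h s" for s
  have cp: "continuous_on {a..b} (\<lambda>s. c / Gamma \<gamma> * rpow (s - a) (\<gamma> - 1))"
    using \<gamma> by (intro continuous_intros continuous_on_rpow) auto
  have cI: "continuous_on {a..b} (rl_integral a \<gamma> h)"
    using \<gamma> by (intro continuous_on_rl_integral ch) auto
  have cU: "continuous_on {a..b} U"
    unfolding U_def by (intro continuous_intros cp cI)
  have IU: "rl_integral a \<nu> U s = c / Gamma (\<nu> + \<gamma>) * rpow (s - a) (\<nu> + \<gamma> - 1) - rl_integral a (\<nu> + \<gamma>) h s"
    if nu: "0 < \<nu>" and s: "s \<in> {a..b}" for \<nu> s
  proof -
    have "rl_integral a \<nu> U s = rl_integral a \<nu> (\<lambda>s. c / Gamma \<gamma> * rpow (s - a) (\<gamma> - 1)) s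
        - rl_integral a \<nu> (rl_integral a \<gamma> h) s"
      unfolding U_def using s
      by (intro rl_integral_diff nu continuous_on_subset[OF cp] continuous_on_subset[OF cI]) auto
    also have "rl_integral a \<nu> (rl_integral a \<gamma> h) s = rl_integral a (\<nu> + \<gamma>) h s"
      by (rule rl_integral_semigroup[OF nu _ ch s]) (use \<gamma> in auto)
    also have "rl_integral a \<nu> (\<lambda>s. c / Gamma \<gamma> * rpow (s - a) (\<gamma> - 1)) s =
        c / Gamma \<gamma> * (Gamma \<gamma> / Gamma (\<nu> + \<gamma>) * rpow (s - a) (\<nu> + \<gamma> - 1))"
      unfolding rl_integral_cmult using rl_integral_power[OF nu, of "\<gamma> - 1" a s] \<gamma> s
      by (simp add: algebra_simps)
    also have "\<dots> = c / Gamma (\<nu> + \<gamma>) * rpow (s - a) (\<nu> + \<gamma> - 1)"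
      using Gamma_real_neq_0[of \<gamma>] \<gamma> by simp
    finally show ?thesis .
  qed
  have Iu: "rl_integral a (2 - \<gamma>) u s = c * (s - a) - rl_integral a 2 h s" if s: "s \<in> {a..b}" for s
  proof (cases "\<alpha> = 2")
    case True
    then have "2 - \<gamma> = \<beta>" using \<gamma> by simp
    then show ?thesis
      using c[OF s] xu[OF s] neg True by (simp add: rl_integral_def[of a 0])
  next
    case False
    then have al: "0 < 2 - \<alpha>" using assms by simp
    have "rl_integral a (2 - \<alpha>) x s = rl_integral a (2 - \<alpha>) (rl_integral a \<beta> u) s"
      by (rule rl_integral_cong) (use xu s in auto)
    also have "\<dots> = rl_integral a (2 - \<alpha> + \<beta>) u s"
      by (rule rl_integral_semigroup[OF al _ cu s]) (use assms in auto)
    also have "2 - \<alpha> + \<beta> = 2 - \<gamma>" by (simp add: \<gamma>_def)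
    finally show ?thesis using c[OF s] neg by simp
  qed
  have uU: "u s = U s" if s: "s \<in> {a..b}" for s
  proof (rule rl_integral_inject[OF _ _ \<open>a < b\<close> cu cU _ s])
    show "rl_integral a (2 - \<gamma>) u s = rl_integral a (2 - \<gamma>) U s" if "s \<in> {a..b}" for s
      using Iu[OF that] IU[OF _ that, of "2 - \<gamma>"] \<gamma> that
      by (auto simp: rpow_def Gamma_numeral)
  qed (use \<gamma> in auto)
  have "x b = rl_integral a \<beta> U b"
    using assms uU xu[of b] rl_integral_cong[of a b u U \<beta>] by auto
  then have "c / Gamma \<alpha> * rpow (b - a) (\<alpha> - 1) = rl_integral a \<alpha> h b"
    using IU[of \<beta> b] assms \<gamma> xab by simp
  then have "c * rpow (b - a) (\<alpha> - 1) = integral {a..b} (\<lambda>s. rpow (b - s) (\<alpha> - 1) * h s)"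
    using Gamma_real_neq_0[of \<alpha>] assms by (simp add: rl_integral_def field_simps)
  moreover have "rpow (b - a) (\<alpha> - 1) \<noteq> 0" using assms by (simp add: rpow_def)
  ultimately have "c = integral {a..b} (\<lambda>s. rpow (b - s) (\<alpha> - 1) * h s) / rpow (b - a) (\<alpha> - 1)"
    by (simp add: field_simps)
  then show ?thesis
    using uU[OF t] Gamma_real_neq_0[of \<gamma>] \<gamma> assms
    by (simp add: U_def rl_integral_def field_simps flip: \<gamma>_def)
qed

text \<open>
  The kernel of the representation above, without the factor \<open>1 / Gamma (\<alpha> - \<beta>)\<close>.
\<close>

definition green :: "real \<Rightarrow> real \<Rightarrow> real \<Rightarrow> real \<Rightarrow> real \<Rightarrow> real \<Rightarrow> real" where
  "green a b \<alpha> \<beta> t s =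
     rpow (t - a) (\<alpha> - \<beta> - 1) * (rpow (b - s) (\<alpha> - 1) / rpow (b - a) (\<alpha> - 1))
     - (if s \<in> {a..t} then rpow (t - s) (\<alpha> - \<beta> - 1) else 0)"

section \<open>Bounds on the Green function\<close>

text \<open>
  For fixed \<open>s\<close> the kernel is nonnegative and increasing in \<open>t\<close> for \<open>t < s\<close>, and decreasing for
  \<open>t \<ge> s\<close>, because the subtracted power, based at \<open>s\<close>, grows faster than the one based at \<open>a\<close>.
  It therefore lies between its value \<open>p s\<close> at \<open>t = s\<close> and the smaller of \<open>0\<close> and its value
  \<open>- r s\<close> at \<open>t = b\<close>.
\<close>

lemma abs_green_le_bound_m:
  assumes "a < b" "0 < \<beta>" "\<alpha> \<le> 2" "\<alpha> - \<beta> - 1 > 0" "t \<in> {a..b}" "s \<in> {a..b}"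
  shows "\<bar>green a b \<alpha> \<beta> t s\<bar> \<le> bound_m a b \<alpha> \<beta> s"
proof -
  define q where "q = \<alpha> - \<beta> - 1"
  define \<rho> where "\<rho> = (b - s) powr (\<alpha> - 1) / (b - a) powr (\<alpha> - 1)"
  have q: "0 < q" "q < 1" using assms by (auto simp: q_def)
  have \<rho>: "0 \<le> \<rho>" "\<rho> \<le> 1" using assms by (auto simp: \<rho>_def intro!: powr_mono2)
  define \<phi> where "\<phi> \<tau> = (\<tau> - a) powr q * \<rho> - (\<tau> - s) powr q" for \<tau>
  have p: "bound_p a b \<alpha> \<beta> s = (s - a) powr q * \<rho>"
    using assms by (simp add: bound_p_def rpow_def q_def \<rho>_def)
  have "(b - a) powr (\<alpha> - 1) = (b - a) powr q * (b - a) powr \<beta>"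
    by (simp add: q_def flip: powr_add)
  then have r: "bound_r a b \<alpha> \<beta> s = - \<phi> b"
    using assms by (simp add: bound_r_def rpow_def q_def \<rho>_def \<phi>_def)
  have dec: "\<phi> y \<le> \<phi> z" if zy: "s \<le> z" "z \<le> y" for y z
  proof (rule DERIV_nonpos_imp_decreasing_open[OF zy(2)])
    show "continuous_on {z..y} \<phi>"
      unfolding \<phi>_def using zy q assms by (intro continuous_intros continuous_on_powr') auto
    fix \<tau> assume \<tau>: "z < \<tau>" "\<tau> < y"
    have pos: "0 < \<tau> - s" "\<tau> - s \<le> \<tau> - a" using \<tau> zy assms by auto
    have "(\<phi> has_real_derivative (q * (\<tau> - a) powr (q - 1) * \<rho> - q * (\<tau> - s) powr (q - 1))) (at \<tau>)"
      unfolding \<phi>_def using pos by (auto intro!: derivative_eq_intros)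
    moreover have "(\<tau> - a) powr (q - 1) * \<rho> \<le> (\<tau> - a) powr (q - 1)"
      using \<rho> by (simp add: mult_left_le)
    moreover have "(\<tau> - a) powr (q - 1) \<le> (\<tau> - s) powr (q - 1)"
      using pos q by (intro powr_mono2') auto
    ultimately show "\<exists>d. (\<phi> has_real_derivative d) (at \<tau>) \<and> d \<le> 0"
      using q by (intro exI[of _ "q * (\<tau> - a) powr (q - 1) * \<rho> - q * (\<tau> - s) powr (q - 1)"])
        (auto simp: mult.assoc)
  qed
  have m: "bound_m a b \<alpha> \<beta> s = max (bound_p a b \<alpha> \<beta> s) (bound_r a b \<alpha> \<beta> s)"
    using assms by (simp add: bound_m_def)
  show ?thesis
  proof (cases "s \<le> t")
    case True
    then have "green a b \<alpha> \<beta> t s = \<phi> t"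
      using assms by (simp add: green_def \<phi>_def rpow_def q_def \<rho>_def)
    moreover have "\<phi> t \<le> \<phi> s" "\<phi> b \<le> \<phi> t" using dec True assms by auto
    moreover have "\<phi> s = bound_p a b \<alpha> \<beta> s" by (simp add: \<phi>_def p)
    ultimately show ?thesis using r m by auto
  next
    case False
    then have "green a b \<alpha> \<beta> t s = (t - a) powr q * \<rho>"
      using assms by (simp add: green_def rpow_def q_def \<rho>_def)
    moreover have "(t - a) powr q * \<rho> \<le> (s - a) powr q * \<rho>"
      using False assms \<rho> q by (intro mult_right_mono powr_mono2) auto
    ultimately show ?thesis using p m \<rho> by auto
  qed
qed

text \<open>
  The choice between the two bounds depends on \<open>t\<close> but not on \<open>s\<close>, so that it can be made outside
  the integral. It matters for \<open>\<alpha> - \<beta> = 1\<close>, where the kernel jumps by \<open>1\<close> at \<open>s = t\<close> and its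
  absolute value is \<open>r s = 1 - p s\<close> for \<open>s \<le> t\<close> and \<open>p s\<close> for \<open>s > t\<close>. As \<open>p\<close> is decreasing,
  \<open>p s \<ge> 1 / 2\<close> for all \<open>s \<le> t\<close> if \<open>p t \<ge> 1 / 2\<close>, and \<open>p s < 1 / 2\<close> for all \<open>s > t\<close> otherwise; so
  the larger of \<open>p t\<close> and \<open>r t\<close> tells which of \<open>p\<close> and \<open>r\<close> dominates the kernel on the whole interval.
\<close>

lemma abs_green_le_bounds:
  assumes "a < b" "0 < \<beta>" "\<alpha> \<le> 2" "\<alpha> - \<beta> - 1 \<ge> 0" "t \<in> {a..b}"
  shows "(\<forall>s\<in>{a..b}. \<bar>green a b \<alpha> \<beta> t s\<bar> \<le> bound_m a b \<alpha> \<beta> s) \<or>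
         (\<forall>s\<in>{a..b}. \<bar>green a b \<alpha> \<beta> t s\<bar> \<le> bound_p a b \<alpha> \<beta> s)"
proof (cases "\<alpha> - \<beta> - 1 > 0")
  case True
  then show ?thesis using abs_green_le_bound_m assms by blast
next
  case False
  then have \<alpha>: "\<alpha> - 1 = \<beta>" using assms by simp
  define \<rho> where "\<rho> s = (b - s) powr \<beta> / (b - a) powr \<beta>" for s
  have \<rho>01: "0 \<le> \<rho> s" "\<rho> s \<le> 1" if "s \<in> {a..b}" for s
    using that assms by (auto simp: \<rho>_def intro!: powr_mono2)
  have mono: "\<rho> y \<le> \<rho> z" if "z \<le> y" "y \<in> {a..b}" for y z
    using that assms by (auto simp: \<rho>_def intro!: divide_right_mono powr_mono2)
  have p: "bound_p a b \<alpha> \<beta> s = \<rho> s" and m: "bound_m a b \<alpha> \<beta> s = 1 - \<rho> s" 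
    and G: "green a b \<alpha> \<beta> t s = \<rho> s - (if s \<in> {a..t} then 1 else 0)" for s
    using assms \<alpha> by (simp_all add: bound_p_def bound_m_def bound_r_def green_def rpow_def \<rho>_def)
  show ?thesis
  proof (cases "\<rho> t \<ge> 1 / 2")
    case True
    have "\<bar>green a b \<alpha> \<beta> t s\<bar> \<le> bound_p a b \<alpha> \<beta> s" if s: "s \<in> {a..b}" for s
      using True \<rho>01[OF s] mono[of s t] assms(5) s by (auto simp: p G)
    then show ?thesis by blast
  next
    case False
    have "\<bar>green a b \<alpha> \<beta> t s\<bar> \<le> bound_m a b \<alpha> \<beta> s" if s: "s \<in> {a..b}" for s
      using False \<rho>01[OF s] mono[of t s] assms(5) s by (auto simp: m G)
    then show ?thesis by blast
  qed
qed

lemma continuous_on_bound_p: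
  assumes "1 \<le> \<alpha>" "\<alpha> - \<beta> - 1 \<ge> 0" "a < b"
  shows "continuous_on {a..b} (bound_p a b \<alpha> \<beta>)"
  unfolding bound_p_def using assms by (intro continuous_intros continuous_on_rpow) (auto simp: rpow_def)

lemma continuous_on_bound_m:
  assumes "1 \<le> \<alpha>" "\<alpha> - \<beta> - 1 \<ge> 0" "a < b"
  shows "continuous_on {a..b} (bound_m a b \<alpha> \<beta>)"
proof -
  have "continuous_on {a..b} (bound_r a b \<alpha> \<beta>)"
    unfolding bound_r_def using assms by (intro continuous_intros continuous_on_rpow) (auto simp: rpow_def)
  then show ?thesis
    using continuous_on_max[OF continuous_on_bound_p[OF assms]]
    by (cases "\<alpha> - \<beta> - 1 > 0") (simp_all add: bound_m_def[abs_def])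
qed

section \<open>The Lyapunov-type inequality\<close>

text \<open>
  Since \<open>x\<close> is the integral of order \<open>\<beta>\<close> of \<open>u\<close>, a bound \<open>M\<close> on \<open>u\<close> gives
  \<open>\<bar>x s\<bar> \<le> M * (rpow (s - a) \<beta> / Gamma (\<beta> + 1))\<close>. So \<open>M\<close> also controls
  \<open>g u + f x\<close>, and the Green representation feeds this back into \<open>u\<close>.
\<close>

lemma bvp_solution_rl_deriv_bound:
  fixes a b \<alpha> \<beta> :: real and f g x :: "real \<Rightarrow> real"
  defines "u \<equiv> rl_deriv_on {a..b} a \<beta> x"
  assumes "a < b" "1 < \<alpha>" "\<alpha> \<le> 2" "0 < \<beta>" "\<beta> \<le> 1" "\<alpha> - \<beta> - 1 \<ge> 0"
    and fg: "continuous_on {a..b} f" "continuous_on {a..b} g"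
    and E: "x \<in> E_space a b \<beta>"
    and bvp: "bvp_solution a b \<alpha> \<beta> f g x"
    and t: "t \<in> {a..b}"
    and M: "\<And>s. s \<in> {a..b} \<Longrightarrow> \<bar>u s\<bar> \<le> M"
    and w: "continuous_on {a..b} w" "\<And>s. s \<in> {a..b} \<Longrightarrow> \<bar>green a b \<alpha> \<beta> t s\<bar> \<le> w s"
  shows "Gamma (\<alpha> - \<beta>) * \<bar>u t\<bar> \<le>
     (integral {a..b} (\<lambda>s. w s * \<bar>g s\<bar>)
      + integral {a..b} (\<lambda>s. w s * \<bar>f s\<bar> * (rpow (s - a) \<beta> / Gamma (\<beta> + 1)))) * M"
proof -
  define h where "h s = g s * u s + f s * x s" for s
  define \<kappa> where "\<kappa> s = rpow (s - a) \<beta> / Gamma (\<beta> + 1)" for s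
  have cx: "continuous_on {a..b} x" and cu: "continuous_on {a..b} u"
    and exb: "rl_deriv_exists_on {a..b} a \<beta> x"
    using E by (auto simp: E_space_def u_def)
  have xa: "x a = 0" using bvp by (auto simp: bvp_solution_def)
  have ch: "continuous_on {a..b} h" unfolding h_def by (intro continuous_intros fg cu cx)
  have c\<kappa>: "continuous_on {a..b} \<kappa>"
    unfolding \<kappa>_def using Gamma_real_neq_0[of "\<beta> + 1"] assms
    by (intro continuous_intros continuous_on_rpow) auto
  have xM: "\<bar>x s\<bar> \<le> M * \<kappa> s" if s: "s \<in> {a..b}" for s
  proof -
    have "x s = rl_integral a \<beta> u s"
      unfolding u_def using assms cx xa exb cu s by (intro rl_integral_rl_deriv) auto
    then show ?thesis
      unfolding \<kappa>_def using rl_integral_bound[of \<beta> a s u M] s M assms(5) continuous_on_subset[OF cu, of "{a..s}"]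
      by auto
  qed
  have hM: "\<bar>h s\<bar> \<le> (\<bar>g s\<bar> + \<bar>f s\<bar> * \<kappa> s) * M" if s: "s \<in> {a..b}" for s
  proof -
    have "\<bar>h s\<bar> \<le> \<bar>g s\<bar> * \<bar>u s\<bar> + \<bar>f s\<bar> * \<bar>x s\<bar>"
      unfolding h_def abs_mult[symmetric] by (rule abs_triangle_ineq)
    also have "\<dots> \<le> \<bar>g s\<bar> * M + \<bar>f s\<bar> * (M * \<kappa> s)"
      using M[OF s] xM[OF s] by (intro add_mono mult_left_mono) auto
    finally show ?thesis by (simp add: algebra_simps)
  qed
  define C where "C = rpow (t - a) (\<alpha> - \<beta> - 1) / rpow (b - a) (\<alpha> - 1)"
  have "((\<lambda>s. rpow (b - s) (\<alpha> - 1) * h s) has_integral integral {a..b} (\<lambda>s. rpow (b - s) (\<alpha> - 1) * h s)) {a..b}"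
    using assms kernel_integrable[of \<alpha> a b h] ch by (intro integrable_integral) auto
  note A = has_integral_mult_right[OF this, of C]
  have "((\<lambda>s. rpow (t - s) (\<alpha> - \<beta> - 1) * h s) has_integral
      integral {a..t} (\<lambda>s. rpow (t - s) (\<alpha> - \<beta> - 1) * h s)) {a..t}"
    using assms kernel_integrable[of "\<alpha> - \<beta>" a t h] continuous_on_subset[OF ch, of "{a..t}"] t
    by (intro integrable_integral) auto
  then have B: "((\<lambda>s. if s \<in> {a..t} then rpow (t - s) (\<alpha> - \<beta> - 1) * h s else 0) has_integral
      integral {a..t} (\<lambda>s. rpow (t - s) (\<alpha> - \<beta> - 1) * h s)) {a..b}"
    using t by (subst has_integral_restrict) auto
  have u_int: "((\<lambda>s. green a b \<alpha> \<beta> t s * h s) has_integral Gamma (\<alpha> - \<beta>) * u t) {a..b}"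
  proof -
    have "(\<lambda>s. green a b \<alpha> \<beta> t s * h s) = (\<lambda>s. C * (rpow (b - s) (\<alpha> - 1) * h s)
        - (if s \<in> {a..t} then rpow (t - s) (\<alpha> - \<beta> - 1) * h s else 0))"
      by (auto simp: green_def C_def algebra_simps)
    moreover have "Gamma (\<alpha> - \<beta>) * u t = C * integral {a..b} (\<lambda>s. rpow (b - s) (\<alpha> - 1) * h s)
        - integral {a..t} (\<lambda>s. rpow (t - s) (\<alpha> - \<beta> - 1) * h s)"
      unfolding C_def h_def u_def
      using bvp_solution_green_representation[OF assms(2-7) fg E bvp t] by simp
    ultimately show ?thesis using has_integral_diff[OF A B] by simp
  qed
  have cont: "continuous_on {a..b} (\<lambda>s. w s * \<bar>g s\<bar>)" "continuous_on {a..b} (\<lambda>s. w s * \<bar>f s\<bar> * \<kappa> s)"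
    by (intro continuous_intros w fg c\<kappa>)+
  then have w_int: "((\<lambda>s. (w s * \<bar>g s\<bar> + w s * \<bar>f s\<bar> * \<kappa> s) * M) has_integral
     (integral {a..b} (\<lambda>s. w s * \<bar>g s\<bar>) + integral {a..b} (\<lambda>s. w s * \<bar>f s\<bar> * \<kappa> s)) * M) {a..b}"
    by (intro has_integral_mult_left has_integral_add integrable_integral integrable_continuous_real)
  have le: "norm (green a b \<alpha> \<beta> t s * h s) \<le> (w s * \<bar>g s\<bar> + w s * \<bar>f s\<bar> * \<kappa> s) * M"
    if s: "s \<in> {a..b}" for s
  proof -
    have "norm (green a b \<alpha> \<beta> t s * h s) \<le> w s * ((\<bar>g s\<bar> + \<bar>f s\<bar> * \<kappa> s) * M)"
      unfolding real_norm_def abs_mult using w(2)[OF s] hM[OF s] by (intro mult_mono) auto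
    then show ?thesis by (simp add: algebra_simps)
  qed
  have "norm (Gamma (\<alpha> - \<beta>) * u t) \<le>
     (integral {a..b} (\<lambda>s. w s * \<bar>g s\<bar>) + integral {a..b} (\<lambda>s. w s * \<bar>f s\<bar> * \<kappa> s)) * M"
    using integral_norm_bound_integral[OF has_integral_integrable[OF u_int] has_integral_integrable[OF w_int] le]
    by (simp only: integral_unique[OF u_int] integral_unique[OF w_int])
  moreover have "0 < Gamma (\<alpha> - \<beta>)" using assms by (intro Gamma_real_pos) auto
  ultimately show ?thesis by (simp add: abs_mult \<kappa>_def)
qed

theorem theorem3p11:
  fixes a b \<alpha> \<beta> :: real and f g x :: "real \<Rightarrow> real"
  assumes "a < b"
    and "1 < \<alpha>" and "\<alpha> \<le> 2"
    and "0 < \<beta>" and "\<beta> \<le> 1"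
    and "\<alpha> - \<beta> - 1 \<ge> 0"
    and "continuous_on {a..b} f" and "continuous_on {a..b} g"
    and "x \<in> E_space a b \<beta>"
    and "\<exists>t\<in>{a..b}. x t \<noteq> 0"
    and "bvp_solution a b \<alpha> \<beta> f g x"
  shows "Gamma (\<alpha> - \<beta>) \<le>
      max (integral {a..b} (\<lambda>s. bound_m a b \<alpha> \<beta> s * \<bar>g s\<bar>))
          (integral {a..b} (\<lambda>s. bound_p a b \<alpha> \<beta> s * \<bar>g s\<bar>))
    + max (integral {a..b} (\<lambda>s. bound_m a b \<alpha> \<beta> s * \<bar>f s\<bar> * (rpow (s - a) \<beta> / Gamma (\<beta> + 1))))
          (integral {a..b} (\<lambda>s. bound_p a b \<alpha> \<beta> s * \<bar>f s\<bar> * (rpow (s - a) \<beta> / Gamma (\<beta> + 1))))"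
    (is "_ \<le> max (?Ig (bound_m a b \<alpha> \<beta>)) _ + max (?If (bound_m a b \<alpha> \<beta>)) _")
proof -
  define u where "u = rl_deriv_on {a..b} a \<beta> x"
  have cx: "continuous_on {a..b} x" and cu: "continuous_on {a..b} u"
    and exb: "rl_deriv_exists_on {a..b} a \<beta> x"
    using assms(9) by (auto simp: E_space_def u_def)
  have xa: "x a = 0" using assms(11) by (auto simp: bvp_solution_def)
  \<comment> \<open>Evaluating the bound where \<open>\<bar>u\<bar>\<close> is maximal makes the same number appear on both sides.\<close>
  obtain t where t: "t \<in> {a..b}" "\<And>s. s \<in> {a..b} \<Longrightarrow> \<bar>u s\<bar> \<le> \<bar>u t\<bar>"
    using continuous_attains_sup[OF compact_Icc _ continuous_on_rabs[OF cu]] assms(1) by fastforce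
  have "0 < \<bar>u t\<bar>"
  proof (rule ccontr)
    assume "\<not> 0 < \<bar>u t\<bar>"
    then have u0: "u s = 0" if "s \<in> {a..b}" for s using t(2)[OF that] by simp
    have "x s = 0" if s: "s \<in> {a..b}" for s
    proof -
      have "x s = rl_integral a \<beta> u s"
        unfolding u_def using assms cx xa exb cu s by (intro rl_integral_rl_deriv) (auto simp: u_def)
      also have "\<dots> = rl_integral a \<beta> (\<lambda>_. 0) s"
        by (rule rl_integral_cong) (use u0 s in auto)
      finally show ?thesis by (simp add: rl_integral_def)
    qed
    then show False using assms(10) by auto
  qed
  have bound: "Gamma (\<alpha> - \<beta>) \<le> ?Ig w + ?If w"
    if "continuous_on {a..b} w" "\<And>s. s \<in> {a..b} \<Longrightarrow> \<bar>green a b \<alpha> \<beta> t s\<bar> \<le> w s" for w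
  proof -
    have "Gamma (\<alpha> - \<beta>) * \<bar>u t\<bar> \<le> (?Ig w + ?If w) * \<bar>u t\<bar>"
      using bvp_solution_rl_deriv_bound[OF assms(1-9,11) t(1) _ that, of "\<bar>u t\<bar>"] t(2)
      by (simp add: u_def)
    then show ?thesis using \<open>0 < \<bar>u t\<bar>\<close> by (simp only: mult_le_cancel_right_pos)
  qed
  \<comment> \<open>With one weight for both integrals, each of the two maxima dominates its summand.\<close>
  from abs_green_le_bounds[OF assms(1,4,3,6) t(1)] show ?thesis
  proof
    assume "\<forall>s\<in>{a..b}. \<bar>green a b \<alpha> \<beta> t s\<bar> \<le> bound_m a b \<alpha> \<beta> s"
    then show ?thesis
      using bound[of "bound_m a b \<alpha> \<beta>"] continuous_on_bound_m[of \<alpha> \<beta> a b] assms by force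
  next
    assume "\<forall>s\<in>{a..b}. \<bar>green a b \<alpha> \<beta> t s\<bar> \<le> bound_p a b \<alpha> \<beta> s"
    then show ?thesis
      using bound[of "bound_p a b \<alpha> \<beta>"] continuous_on_bound_p[of \<alpha> \<beta> a b] assms by force
  qed
qed

end
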